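(* (Trench factorization.) If $Lx=0$ has a positive solution on an interval $[a,b)\subset(0,\infty)$ with $b\le\infty$, then there are positive functions $\gamma_1$ and $\gamma_2$ on $[a,b)$ with $$\int_a^b\frac{1}{\gamma_2(t)}\,d_\alpha t=\infty$$ such that for any $x\in\mathbb D$ we have the Trench factorization $$Lx(t)=\gamma_1(t)\,D^{\alpha}\left\{\gamma_2D^{\alpha}[\gamma_1x]\right\}(t)\qquad\text{for all }t\in[a,b).$$
   Context: $\mathcal I\subseteq\mathbb R$ is an interval containing $[a,b)$. The functions $\kappa_0,\kappa_1:[0,1]\times\mathcal I\to[0,\infty)$ are continuous and satisfy, for all $t\in\mathcal I$: $\lim_{\alpha\to0^+}\kappa_1(\alpha,t)=1$, $\lim_{\alpha\to0^+}\kappa_0(\alpha,t)=0$, $\lim_{\alpha\to1^-}\kappa_1(\alpha,t)=0$, $\lim_{\alpha\to1^-}\kappa_0(\alpha,t)=1$, $\kappa_1(\alpha,t)\ne0$ for $\alpha\in[0,1)$, and $\kappa_0(\alpha,t)\neq0$ for $\alpha\in(0,1]$. Fix $\alpha\in(0,1]$ and write $\kappa_j(t)=\kappa_j(\alpha,t)$. The conformable (proportional) derivative is $D^{\alpha}f(t)=\kappa_1(t)f(t)+\kappa_0(t)f'(t)$. Write $d_\alpha t=dt/\kappa_0(t)$; integrals up to $b$ are improper integrals (limits as the upper limit tends to $b^-$). Let $p,q$ be continuous on $\mathcal I$ with $p(t)>0$ for all $t\in\mathcal I$, and set $Lx=D^{\alpha}[pD^{\alpha}x]+qx$. $\mathbb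 D$ is the set of all continuous functions $x$ such that $D^{\alpha}x$ and $D^{\alpha}[pD^{\alpha}x]$ exist and are continuous on $\mathcal I$; a solution of $Lx=0$ on an interval is a function with this regularity there and $Lx=0$ at every point of that interval. *)

theory Defs
  imports "HOL-Analysis.Analysis"
begin

definition Ico_ereal :: "real \<Rightarrow> ereal \<Rightarrow> real set" where
  "Ico_ereal a b = {t. a \<le> t \<and> ereal t < b}"

definition conformable_kernels ::
  "real set \<Rightarrow> (real \<Rightarrow> real \<Rightarrow> real) \<Rightarrow> (real \<Rightarrow> real \<Rightarrow> real) \<Rightarrow> bool" where
  "conformable_kernels I \<kappa>0 \<kappa>1 \<longleftrightarrow>
     continuous_on ({0..1} \<times> I) (\<lambda>(\<alpha>, t). \<kappa>0 \<alpha> t) \<and>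
     continuous_on ({0..1} \<times> I) (\<lambda>(\<alpha>, t). \<kappa>1 \<alpha> t) \<and>
     (\<forall>\<alpha>\<in>{0..1}. \<forall>t\<in>I. 0 \<le> \<kappa>0 \<alpha> t \<and> 0 \<le> \<kappa>1 \<alpha> t) \<and>
     (\<forall>t\<in>I.
        ((\<lambda>\<alpha>. \<kappa>1 \<alpha> t) \<longlongrightarrow> 1) (at_right 0) \<and>
        ((\<lambda>\<alpha>. \<kappa>0 \<alpha> t) \<longlongrightarrow> 0) (at_right 0) \<and>
        ((\<lambda>\<alpha>. \<kappa>1 \<alpha> t) \<longlongrightarrow> 0) (at_left 1) \<and>
        ((\<lambda>\<alpha>. \<kappa>0 \<alpha> t) \<longlongrightarrow> 1) (at_left 1) \<and>
        (\<forall>\<alpha>\<in>{0..<1}. \<kappa>1 \<alpha> t \<noteq> 0) \<and>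
        (\<forall>\<alpha>\<in>{0<..1}. \<kappa>0 \<alpha> t \<noteq> 0))"

text \<open>
  From here on \<open>k0\<close> and \<open>k1\<close> stand for the kernels at a fixed \<open>\<alpha>\<close>.
  The ordinary derivative is taken within the interval \<open>J\<close> on which the function is
  considered, so it is one-sided at an endpoint belonging to \<open>J\<close>. The value is
  meaningful only where \<open>f\<close> is differentiable within \<open>J\<close>; since \<open>k0\<close> does not vanish,
  this is exactly the existence of the conformable derivative, and it is
  required explicitly as \<open>f differentiable_on J\<close> below.
\<close>

definition conformable_deriv ::
  "(real \<Rightarrow> real) \<Rightarrow> (real \<Rightarrow> real) \<Rightarrow> real set \<Rightarrow> (real \<Rightarrow> real) \<Rightarrow> real \<Rightarrow> real" where
  "conformable_deriv k0 k1 J f t =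
     k1 t * f t + k0 t * vector_derivative f (at t within J)"

definition conformable_domain ::
  "(real \<Rightarrow> real) \<Rightarrow> (real \<Rightarrow> real) \<Rightarrow> (real \<Rightarrow> real) \<Rightarrow> real set \<Rightarrow> (real \<Rightarrow> real) set" where
  "conformable_domain k0 k1 p J =
     {x. continuous_on J x \<and>
         x differentiable_on J \<and>
         continuous_on J (conformable_deriv k0 k1 J x) \<and>
         (\<lambda>s. p s * conformable_deriv k0 k1 J x s) differentiable_on J \<and>
         continuous_on J
           (conformable_deriv k0 k1 J (\<lambda>s. p s * conformable_deriv k0 k1 J x s))}"

definition conformable_SL ::
  "(real \<Rightarrow> real) \<Rightarrow> (real \<Rightarrow> real) \<Rightarrow> (real \<Rightarrow> real) \<Rightarrow> (real \<Rightarrow> real) \<Rightarrow> real set \<Rightarrow>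
   (real \<Rightarrow> real) \<Rightarrow> real \<Rightarrow> real" where
  "conformable_SL k0 k1 p q J x t =
     conformable_deriv k0 k1 J (\<lambda>s. p s * conformable_deriv k0 k1 J x s) t + q t * x t"

definition conformable_solution ::
  "(real \<Rightarrow> real) \<Rightarrow> (real \<Rightarrow> real) \<Rightarrow> (real \<Rightarrow> real) \<Rightarrow> (real \<Rightarrow> real) \<Rightarrow> real set \<Rightarrow>
   (real \<Rightarrow> real) \<Rightarrow> bool" where
  "conformable_solution k0 k1 p q J x \<longleftrightarrow>
     x \<in> conformable_domain k0 k1 p J \<and> (\<forall>t\<in>J. conformable_SL k0 k1 p q J x t = 0)"

text \<open>
  The improper integral of \<open>f\<close> over \<open>[a, b)\<close> with respect to \<open>dt / k0 t\<close> is
  \<open>+\<infinity>\<close>. Integrability on compact subintervals is part of the condition because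
  \<open>integral\<close> is \<open>0\<close> by convention for non-integrable functions.
\<close>

definition conformable_integral_infinite ::
  "(real \<Rightarrow> real) \<Rightarrow> real \<Rightarrow> ereal \<Rightarrow> (real \<Rightarrow> real) \<Rightarrow> bool" where
  "conformable_integral_infinite k0 a b f \<longleftrightarrow>
     (\<forall>T\<in>Ico_ereal a b. (\<lambda>t. f t / k0 t) integrable_on {a..T}) \<and>
     filterlim ((\<lambda>T. integral {a..T} (\<lambda>t. f t / k0 t)) \<circ> real_of_ereal) at_top (at_left b)"

end

theory Submission
  imports Defs
begin

text \<open>
  Let \<open>E = exp (- \<integral> k1/k0)\<close>, so that the conformable derivative of \<open>f\<close> is \<open>k0 E (f/E)'\<close>. If
  \<open>u > 0\<close> solves the equation and \<open>W = u p Dx - x p Du = p k0 u\<^sup>2 (x/u)'\<close>, then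
  \<open>u Lx = 2 k1 W + k0 W' = k0 E\<^sup>2 (W/E\<^sup>2)'\<close>, which gives the Polya factorization
  \<open>Lx = (k0 E\<^sup>2/u) (P (x/u)')'\<close> with \<open>P = p k0 u\<^sup>2/E\<^sup>2\<close>. When \<open>\<integral> 1/P\<close> diverges at \<open>b\<close>
  this is already a Trench factorization. Otherwise put \<open>R t = \<integral>\<^sub>t\<^sup>b 1/P\<close>; then
  \<open>(P y')' = (1/R) (P R\<^sup>2 (y/R)')'\<close>, and \<open>1/R\<close> is an antiderivative of \<open>1/(P R\<^sup>2)\<close> that
  tends to infinity at \<open>b\<close>.
\<close>

section \<open>Calculus on half-open intervals whose right endpoint may be infinite\<close>

lemma Ico_ereal_greater:
  assumes "t \<in> Ico_ereal a b"
  obtains T where "T \<in> Ico_ereal a b" "t < T"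
proof -
  from assms have "a \<le> t" "ereal t < b" by (auto simp: Ico_ereal_def)
  then obtain T where "ereal t < ereal T" "ereal T < b"
    using ereal_dense2 by blast
  with \<open>a \<le> t\<close> show ?thesis by (intro that[of T]) (auto simp: Ico_ereal_def)
qed

lemma Ico_ereal_atLeastAtMost_subset:
  assumes "a \<le> S" "T \<in> Ico_ereal a b"
  shows "{S..T} \<subseteq> Ico_ereal a b"
  using assms by (auto simp: Ico_ereal_def elim: le_less_trans[rotated])

text \<open>On the neighbourhood \<open>{..<T}\<close> of \<open>t\<close> the two sets coincide.
  This reduces derivatives within the half-open interval to derivatives within a compact
  one.\<close>

lemma at_within_Ico_ereal:
  assumes "t \<in> Ico_ereal a b" "T \<in> Ico_ereal a b" "t < T"
  shows "at t within Ico_ereal a b = at t within {a..T}"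
proof (rule at_within_nhd[of t "{..<T}"])
  show "Ico_ereal a b \<inter> {..<T} - {t} = {a..T} \<inter> {..<T} - {t}"
    using Ico_ereal_atLeastAtMost_subset[OF order_refl assms(2)] by (auto simp: Ico_ereal_def)
qed (use assms in auto)

text \<open>Needed for derivatives within the interval to be unique, also at \<open>a\<close>, where
  they are one-sided.\<close>

lemma at_within_Ico_ereal_neq_bot:
  assumes "t \<in> Ico_ereal a b"
  shows "at t within Ico_ereal a b \<noteq> bot"
proof -
  obtain T where T: "T \<in> Ico_ereal a b" "t < T" by (rule Ico_ereal_greater[OF assms])
  have "t \<in> {a..T}" "a < T" using assms T by (auto simp: Ico_ereal_def)
  then show ?thesis
    unfolding at_within_Ico_ereal[OF assms T] by (simp add: trivial_limit_within islimpt_Icc)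
qed

text \<open>Differentiability is local: for each \<open>t\<close> a compact interval reaching beyond
  \<open>t\<close> suffices, although \<open>h\<close> may fail to be integrable up to
  \<open>b\<close>.\<close>

lemma Ico_ereal_antiderivative:
  fixes h :: "real \<Rightarrow> real"
  assumes "continuous_on (Ico_ereal a b) h"
  obtains H where
    "\<And>t. t \<in> Ico_ereal a b \<Longrightarrow> (H has_real_derivative h t) (at t within Ico_ereal a b)"
proof (rule that[of "\<lambda>t. integral {a..t} h"])
  fix t assume t: "t \<in> Ico_ereal a b"
  obtain T where T: "T \<in> Ico_ereal a b" "t < T" by (rule Ico_ereal_greater[OF t])
  have "continuous_on {a..T} h"
    using assms Ico_ereal_atLeastAtMost_subset[OF order_refl T(1)] by (rule continuous_on_subset)
  moreover have "t \<in> {a..T}" using t T by (auto simp: Ico_ereal_def)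
  ultimately show "((\<lambda>t. integral {a..t} h) has_real_derivative h t) (at t within Ico_ereal a b)"
    unfolding at_within_Ico_ereal[OF t T] by (rule integral_has_real_derivative)
qed

lemma Ico_ereal_increment_integral:
  fixes F g :: "real \<Rightarrow> real"
  assumes F: "\<And>t. t \<in> Ico_ereal a b \<Longrightarrow> (F has_real_derivative g t) (at t within Ico_ereal a b)"
    and "S \<in> Ico_ereal a b" "T \<in> Ico_ereal a b" "S \<le> T"
  shows "(g has_integral (F T - F S)) {S..T}"
proof (rule fundamental_theorem_of_calculus[OF \<open>S \<le> T\<close>])
  have sub: "{S..T} \<subseteq> Ico_ereal a b"
    using Ico_ereal_atLeastAtMost_subset[OF _ assms(3)] assms(2) by (simp add: Ico_ereal_def)
  fix t assume "t \<in> {S..T}"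
  then show "(F has_vector_derivative g t) (at t within {S..T})"
    using DERIV_subset[OF F sub] sub by (auto simp: has_real_derivative_iff_has_vector_derivative)
qed

section \<open>Divergence of improper integrals at the right endpoint\<close>

text \<open>The integral over \<open>{a..T}\<close> is \<open>F T - F a\<close>, and
  \<open>F\<close> is nondecreasing because the integrand is nonnegative, so unboundedness above
  already forces the limit to be infinite.\<close>

lemma conformable_integral_infinite_antiderivative:
  assumes ab: "ereal a < b"
    and F: "\<And>t. t \<in> Ico_ereal a b \<Longrightarrow>
          (F has_real_derivative f t / k0 t) (at t within Ico_ereal a b)"
    and nonneg: "\<And>t. t \<in> Ico_ereal a b \<Longrightarrow> 0 \<le> f t / k0 t"
    and unbdd: "\<And>Z. \<exists>T\<in>Ico_ereal a b. Z \<le> F T"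
  shows "conformable_integral_infinite k0 a b f"
  unfolding conformable_integral_infinite_def
proof (intro conjI ballI)
  have a: "a \<in> Ico_ereal a b" using ab by (simp add: Ico_ereal_def)
  have int: "((\<lambda>t. f t / k0 t) has_integral (F T - F S)) {S..T}"
    if "S \<in> Ico_ereal a b" "T \<in> Ico_ereal a b" "S \<le> T" for S T
    by (rule Ico_ereal_increment_integral[OF F that])
  show "(\<lambda>t. f t / k0 t) integrable_on {a..T}" if "T \<in> Ico_ereal a b" for T
    using int[OF a that] that by (auto simp: Ico_ereal_def)
  show "filterlim ((\<lambda>T. integral {a..T} (\<lambda>t. f t / k0 t)) \<circ> real_of_ereal) at_top (at_left b)"
    unfolding filterlim_at_top
  proof
    fix Z :: real
    \<comment> \<open>The summand \<open>F a\<close> offsets the lower limit of the integral; by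
      monotonicity \<open>S\<close> is a threshold for the bound near \<open>b\<close>.\<close>
    obtain S where S: "S \<in> Ico_ereal a b" "Z + F a \<le> F S" using unbdd by blast
    have "Z \<le> integral {a..real_of_ereal y} (\<lambda>t. f t / k0 t)" if y: "ereal S < y" "y < b" for y
    proof -
      from y obtain T where T: "y = ereal T" by (cases y) auto
      have J: "T \<in> Ico_ereal a b" "S \<le> T" "a \<le> T" using y S(1) by (auto simp: T Ico_ereal_def)
      have "{S..T} \<subseteq> Ico_ereal a b"
        using Ico_ereal_atLeastAtMost_subset[OF _ J(1)] S(1) by (simp add: Ico_ereal_def)
      then have "0 \<le> F T - F S"
        using has_integral_nonneg[OF int[OF S(1) J(1,2)]] nonneg by blast
      then show ?thesis using integral_unique[OF int[OF a J(1,3)]] S(2) by (simp add: T)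
    qed
    moreover have "ereal S < b" using S(1) by (simp add: Ico_ereal_def)
    ultimately show "\<forall>\<^sub>F y in at_left b.
        Z \<le> ((\<lambda>T. integral {a..T} (\<lambda>t. f t / k0 t)) \<circ> real_of_ereal) y"
      by (subst eventually_at_left[of "ereal S"]) auto
  qed
qed

text \<open>\<open>c = 0\<close> and \<open>c = 1\<close> occur according as \<open>\<integral> h\<close> diverges or converges at \<open>b\<close>.\<close>

lemma divergent_rescaling:
  fixes h :: "real \<Rightarrow> real"
  assumes ab: "ereal a < b"
    and cont: "continuous_on (Ico_ereal a b) h" and pos: "\<And>t. t \<in> Ico_ereal a b \<Longrightarrow> 0 < h t"
  obtains R :: "real \<Rightarrow> real" and c :: real and F :: "real \<Rightarrow> real" where
    "\<forall>t\<in>Ico_ereal a b. 0 < R t"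
    "\<forall>t\<in>Ico_ereal a b. (R has_real_derivative - c * h t) (at t within Ico_ereal a b)"
    "\<forall>t\<in>Ico_ereal a b. (F has_real_derivative h t / (R t)\<^sup>2) (at t within Ico_ereal a b)"
    "\<forall>Z. \<exists>T\<in>Ico_ereal a b. Z \<le> F T"
proof -
  let ?J = "Ico_ereal a b"
  have a: "a \<in> ?J" using ab by (simp add: Ico_ereal_def)
  obtain H where H: "\<And>t. t \<in> ?J \<Longrightarrow> (H has_real_derivative h t) (at t within ?J)"
    using Ico_ereal_antiderivative[OF cont] by blast
  show ?thesis
  proof (cases "bdd_above (H ` ?J)")
    case False
    then have "\<exists>T\<in>?J. Z \<le> H T" for Z
      by (force simp: bdd_above_def not_le intro: less_imp_le)
    then show ?thesis by (intro that[of "\<lambda>_. 1" 0 H]) (use H in auto)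
  next
    case True
    \<comment> \<open>As \<open>H\<close> increases, \<open>S\<close> is its limit at
      \<open>b\<close>, and \<open>S - H t\<close> is the tail integral of \<open>h\<close> from
      \<open>t\<close> to \<open>b\<close>.\<close>
    define S where "S = (SUP t\<in>?J. H t)"
    \<comment> \<open>Strict growth keeps \<open>H\<close> from attaining its supremum, so the tail
      stays positive.\<close>
    have strict: "H t < H T" if "t \<in> ?J" "T \<in> ?J" "t < T" for t T
    proof (rule DERIV_pos_imp_increasing_open[OF \<open>t < T\<close>])
      have sub: "{t..T} \<subseteq> ?J"
        using Ico_ereal_atLeastAtMost_subset[OF _ that(2)] that(1) by (simp add: Ico_ereal_def)
      show "continuous_on {t..T} H"
        using sub by (meson H DERIV_continuous_on continuous_on_subset)
      fix s assume s: "t < s" "s < T"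
      \<comment> \<open>The monotonicity criterion asks for two-sided derivatives, which are
        available at interior points.\<close>
      have "s \<in> interior {t..T}" using s by simp
      then have "at s within ?J = at s" using sub interior_mono at_within_interior by blast
      then show "\<exists>y. (H has_real_derivative y) (at s) \<and> 0 < y"
        using H[of s] pos[of s] sub s by (metis atLeastAtMost_iff less_imp_le subsetD)
    qed
    have less: "H t < S" if t: "t \<in> ?J" for t
    proof -
      obtain T where T: "T \<in> ?J" "t < T" by (rule Ico_ereal_greater[OF t])
      have "H T \<le> S" unfolding S_def by (rule cSUP_upper[OF T(1) True])
      with strict[OF t T] show ?thesis by simp
    qed
    have "((\<lambda>t. 1 / (S - H t)) has_real_derivative h t / (S - H t)\<^sup>2) (at t within ?J)"
      if "t \<in> ?J" for t
      using less[OF that]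
      by (auto intro!: derivative_eq_intros H that simp: power2_eq_square)
    moreover have "\<exists>T\<in>?J. Z \<le> 1 / (S - H T)" for Z
    proof -
      \<comment> \<open>The maximum with 1 keeps \<open>e\<close> positive whatever the sign of
        \<open>Z\<close>.\<close>
      define e where "e = 1 / max Z 1"
      have "S - e < S" by (simp add: e_def)
      then obtain T where T: "T \<in> ?J" "S - e < H T"
        unfolding S_def using less_cSUP_iff[OF _ True] a by blast
      have "Z \<le> 1 / e" by (simp add: e_def)
      also have "\<dots> \<le> 1 / (S - H T)" using T less[OF T(1)] by (intro divide_left_mono) (auto simp: e_def)
      finally show ?thesis using T(1) by blast
    qed
    moreover have "((\<lambda>t. S - H t) has_real_derivative - 1 * h t) (at t within ?J)" if "t \<in> ?J" for t
      by (auto intro!: derivative_eq_intros H that)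
    ultimately show ?thesis using less by (intro that[of "\<lambda>t. S - H t" 1 "\<lambda>t. 1 / (S - H t)"]) auto
  qed
qed

section \<open>Conformable derivatives and the factorization identity\<close>

lemma conformable_deriv_eq:
  assumes "(f has_real_derivative d) (at t within J)" "at t within J \<noteq> bot"
  shows "conformable_deriv k0 k1 J f t = k1 t * f t + k0 t * d"
  using assms by (simp add: conformable_deriv_def has_real_derivative_iff_has_vector_derivative
      vector_derivative_within)

text \<open>In the factorization \<open>x\<close> lives on \<open>I\<close>, but the positive
  solution only on \<open>J\<close>. Derivatives within \<open>I\<close> restrict to
  \<open>J\<close> with the same values, so both functions can be handled with derivatives within
  \<open>J\<close>.\<close>

lemma conformable_domain_derivatives:
  fixes I J :: "real set"
  assumes x: "x \<in> conformable_domain k0 k1 p I" and "J \<subseteq> I" "t \<in> J" and nb: "at t within J \<noteq> bot"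
  obtains x' m' where
    "(x has_real_derivative x') (at t within J)"
    "((\<lambda>s. p s * conformable_deriv k0 k1 I x s) has_real_derivative m') (at t within J)"
    "conformable_deriv k0 k1 I x t = k1 t * x t + k0 t * x'"
    "conformable_SL k0 k1 p q I x t =
       k1 t * (p t * conformable_deriv k0 k1 I x t) + k0 t * m' + q t * x t"
proof -
  let ?m = "\<lambda>s. p s * conformable_deriv k0 k1 I x s"
  have t: "t \<in> I" using assms by blast
  have nbI: "at t within I \<noteq> bot" using nb at_le[OF \<open>J \<subseteq> I\<close>, of t] by (auto simp: bot_unique)
  have "x differentiable (at t within I)" "?m differentiable (at t within I)"
    using x t by (auto simp: conformable_domain_def differentiable_on_def)
  then obtain x' m' where d: "(x has_real_derivative x') (at t within I)"
      "(?m has_real_derivative m') (at t within I)"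
    by (meson real_differentiableE)
  show ?thesis
    by (rule that[OF DERIV_subset[OF d(1) \<open>J \<subseteq> I\<close>] DERIV_subset[OF d(2) \<open>J \<subseteq> I\<close>]
          conformable_deriv_eq[OF d(1) nbI]])
      (simp add: conformable_SL_def conformable_deriv_eq[OF d(2) nbI])
qed

text \<open>
  With the Wronskian \<open>W = u p Dx - x p Du\<close>, the function \<open>E (R W/E\<^sup>2 + c x/u)\<close> equals
  \<open>\<gamma>2 D[\<gamma>1 x]\<close> and, unlike the latter, is visibly differentiable although \<open>p\<close> need not be.
\<close>

lemma trench_factorization_pointwise:
  fixes I J :: "real set" and c :: real
  assumes JI: "J \<subseteq> I" and nb: "\<And>t. t \<in> J \<Longrightarrow> at t within J \<noteq> bot"
    and k0: "\<And>t. t \<in> J \<Longrightarrow> 0 < k0 t" and p: "\<And>t. t \<in> J \<Longrightarrow> 0 < p t"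
    and u: "conformable_solution k0 k1 p q J u" and upos: "\<And>t. t \<in> J \<Longrightarrow> 0 < u t"
    and E: "\<And>t. t \<in> J \<Longrightarrow> (E has_real_derivative - (k1 t / k0 t) * E t) (at t within J)"
    and Epos: "\<And>t. t \<in> J \<Longrightarrow> 0 < E t"
    and R: "\<And>t. t \<in> J \<Longrightarrow>
          (R has_real_derivative - c * ((E t)\<^sup>2 / (p t * k0 t * (u t)\<^sup>2))) (at t within J)"
    and Rpos: "\<And>t. t \<in> J \<Longrightarrow> 0 < R t"
    and x: "x \<in> conformable_domain k0 k1 p I"
    and \<gamma>1: "\<gamma>1 = (\<lambda>t. E t / (u t * R t))"
    and \<gamma>2: "\<gamma>2 = (\<lambda>t. p t * (u t * R t)\<^sup>2 / (E t)\<^sup>2)"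
  shows "(\<lambda>s. \<gamma>1 s * x s) differentiable_on J"
    and "(\<lambda>s. \<gamma>2 s * conformable_deriv k0 k1 J (\<lambda>r. \<gamma>1 r * x r) s) differentiable_on J"
    and "\<And>t. t \<in> J \<Longrightarrow> conformable_SL k0 k1 p q I x t =
          \<gamma>1 t * conformable_deriv k0 k1 J
            (\<lambda>s. \<gamma>2 s * conformable_deriv k0 k1 J (\<lambda>r. \<gamma>1 r * x r) s) t"
proof -
  let ?X = "conformable_deriv k0 k1 I x" and ?U = "conformable_deriv k0 k1 J u"
  let ?G = "\<lambda>s. \<gamma>2 s * conformable_deriv k0 k1 J (\<lambda>r. \<gamma>1 r * x r) s"
  define W where "W = (\<lambda>s. u s * (p s * ?X s) - x s * (p s * ?U s))"
  define V where "V = (\<lambda>s. E s * (R s * W s / (E s)\<^sup>2 + c * x s / u s))"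
  have udom: "u \<in> conformable_domain k0 k1 p J"
    and Lu: "\<And>t. t \<in> J \<Longrightarrow> conformable_SL k0 k1 p q J u t = 0"
    using u by (auto simp: conformable_solution_def)
  have first: "((\<lambda>s. \<gamma>1 s * x s) differentiable (at t within J)) \<and> ?G t = V t" if t: "t \<in> J" for t
  proof -
    obtain x' m' where x': "(x has_real_derivative x') (at t within J)"
      and X: "?X t = k1 t * x t + k0 t * x'"
      by (rule conformable_domain_derivatives[OF x JI t nb[OF t], where q = q]) blast
    obtain u' n' where u': "(u has_real_derivative u') (at t within J)"
      and U: "?U t = k1 t * u t + k0 t * u'"
      by (rule conformable_domain_derivatives[OF udom subset_refl t nb[OF t], where q = q]) blast
    note nz = less_imp_neq[OF k0[OF t], symmetric] less_imp_neq[OF p[OF t], symmetric]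
      less_imp_neq[OF upos[OF t], symmetric] less_imp_neq[OF Epos[OF t], symmetric]
      less_imp_neq[OF Rpos[OF t], symmetric]
    define r where "r = - c * ((E t)\<^sup>2 / (p t * k0 t * (u t)\<^sup>2))"
    have R': "(R has_real_derivative r) (at t within J)" unfolding r_def by (rule R[OF t])
    let ?d = "((- (k1 t / k0 t) * E t) * (u t * R t) - E t * (u' * R t + u t * r)) / (u t * R t)\<^sup>2 * x t
        + E t / (u t * R t) * x'"
    have d: "((\<lambda>s. \<gamma>1 s * x s) has_real_derivative ?d) (at t within J)"
      unfolding \<gamma>1
      by (rule DERIV_cong[OF DERIV_mult[OF DERIV_divide[OF E[OF t] DERIV_mult[OF u' R']] x']])
        (use nz in \<open>simp_all add: power2_eq_square ac_simps\<close>)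
    let ?w = "u t * x' - x t * u'"
    \<comment> \<open>The terms with \<open>k1\<close> cancel because
      \<open>k1 E + k0 E' = 0\<close>, which leaves the ordinary Wronskian \<open>?w\<close> and the
      contribution of \<open>R'\<close>.\<close>
    have "conformable_deriv k0 k1 J (\<lambda>r. \<gamma>1 r * x r) t = k1 t * (\<gamma>1 t * x t) + k0 t * ?d"
      by (rule conformable_deriv_eq[OF d nb[OF t]])
    also have "\<dots> = E t / (u t * R t)\<^sup>2 * (k0 t * R t * ?w - k0 t * u t * x t * r)"
      unfolding \<gamma>1 using nz
      by (simp add: divide_simps) (simp add: algebra_simps power2_eq_square)
    also have "\<dots> = E t / (u t * R t)\<^sup>2 * (k0 t * R t * ?w + c * (E t)\<^sup>2 * x t / (p t * u t))"
      unfolding r_def using nz by (simp add: power2_eq_square)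
    finally have "?G t = (k0 t * R t * ?w + c * (E t)\<^sup>2 * x t / (p t * u t)) * p t / E t"
      unfolding \<gamma>2 using nz by (simp add: power2_eq_square)
    also have "\<dots> = V t"
      unfolding V_def W_def X U using nz by (simp add: field_simps power2_eq_square)
    finally have "?G t = V t" .
    with d show ?thesis
      by (auto simp: real_differentiable_def)
  qed
  show "(\<lambda>s. \<gamma>1 s * x s) differentiable_on J"
    using first by (simp add: differentiable_on_def)
  \<comment> \<open>The asserted derivative is the factorization identity solved for the ordinary
    derivative of \<open>?G\<close>.\<close>
  have second: "(?G has_real_derivative
       (conformable_SL k0 k1 p q I x t / \<gamma>1 t - k1 t * ?G t) / k0 t) (at t within J)"
    if t: "t \<in> J" for t
  proof -
    obtain x' m' where x': "(x has_real_derivative x') (at t within J)"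
      and m': "((\<lambda>s. p s * ?X s) has_real_derivative m') (at t within J)"
      and X: "?X t = k1 t * x t + k0 t * x'"
      and LX: "conformable_SL k0 k1 p q I x t = k1 t * (p t * ?X t) + k0 t * m' + q t * x t"
      by (rule conformable_domain_derivatives[OF x JI t nb[OF t], where q = q]) blast
    obtain u' n' where u': "(u has_real_derivative u') (at t within J)"
      and n': "((\<lambda>s. p s * ?U s) has_real_derivative n') (at t within J)"
      and U: "?U t = k1 t * u t + k0 t * u'"
      and LU: "conformable_SL k0 k1 p q J u t = k1 t * (p t * ?U t) + k0 t * n' + q t * u t"
      by (rule conformable_domain_derivatives[OF udom subset_refl t nb[OF t], where q = q]) blast
    note nz = less_imp_neq[OF k0[OF t], symmetric] less_imp_neq[OF p[OF t], symmetric]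
      less_imp_neq[OF upos[OF t], symmetric] less_imp_neq[OF Epos[OF t], symmetric]
      less_imp_neq[OF Rpos[OF t], symmetric]
    let ?R' = "- c * ((E t)\<^sup>2 / (p t * k0 t * (u t)\<^sup>2))" and ?E' = "- (k1 t / k0 t) * E t"
    define L where "L = conformable_SL k0 k1 p q I x t"
    define W' where "W' = u' * (p t * ?X t) + u t * m' - (x' * (p t * ?U t) + x t * n')"
    have W: "(W has_real_derivative W') (at t within J)"
      unfolding W_def W'_def
      by (rule DERIV_cong[OF DERIV_diff[OF DERIV_mult[OF u' m'] DERIV_mult[OF x' n']]])
        (simp add: algebra_simps)
    have wronskian: "W t = p t * k0 t * (u t * x' - x t * u')"
      unfolding W_def X U by (simp add: algebra_simps)
    \<comment> \<open>With \<open>n'\<close> eliminated by \<open>Lu = 0\<close> and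
      \<open>m'\<close> by the definition of \<open>L\<close>, the \<open>q\<close> terms cancel in
      \<open>W'\<close>, and the Lagrange identity \<open>u L = k0 W' + 2 k1 W\<close>
      remains.\<close>
    have n'_eq: "n' = - (k1 t * (p t * ?U t) + q t * u t) / k0 t"
      using LU Lu[OF t] nz by (simp add: field_simps)
    have m'_eq: "m' = (L - k1 t * (p t * ?X t) - q t * x t) / k0 t"
      using LX nz by (simp add: L_def field_simps)
    have W'_eq: "W' = (u t * L - 2 * k1 t * W t) / k0 t"
      unfolding wronskian W'_def n'_eq m'_eq X U using nz by (simp add: field_simps)
    let ?A = "R t * W t / (E t)\<^sup>2 + c * x t / u t"
    let ?A' = "((?R' * W t + R t * W') * (E t)\<^sup>2 - R t * W t * (2 * E t * ?E')) / (E t)^4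
        + c * (x' * u t - x t * u') / (u t)\<^sup>2"
    have E2: "((\<lambda>s. (E s)\<^sup>2) has_real_derivative 2 * E t * ?E') (at t within J)"
      by (auto intro!: derivative_eq_intros E[OF t])
    note dA = DERIV_add[OF DERIV_divide[OF DERIV_mult[OF R[OF t] W] E2]
        DERIV_divide[OF DERIV_cmult[OF x', of c] u']]
    have V: "(V has_real_derivative ?E' * ?A + E t * ?A') (at t within J)"
      unfolding V_def
      by (rule DERIV_cong[OF DERIV_mult[OF E[OF t] dA]])
        (use nz in \<open>simp_all add: power2_eq_square power4_eq_xxxx algebra_simps\<close>)
    \<comment> \<open>Two cancellations: the term from \<open>R'\<close> equals
      \<open>- c (x/u)'\<close>, since \<open>W = p k0 (u x' - x u')\<close>, and differentiating
      \<open>1/E\<^sup>2\<close> removes \<open>2 k1 W\<close>.\<close>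
    have A': "?A' = R t * u t * L / (k0 t * (E t)\<^sup>2)"
      unfolding W'_eq wronskian using nz
      by (simp add: field_simps power2_eq_square power4_eq_xxxx)
    have "?E' * ?A + E t * ?A' = (L / \<gamma>1 t - k1 t * V t) / k0 t"
      unfolding A' unfolding V_def \<gamma>1 using nz by (simp add: field_simps power2_eq_square)
    with V have "(V has_real_derivative (L / \<gamma>1 t - k1 t * ?G t) / k0 t) (at t within J)"
      using first[OF t] by simp
    \<comment> \<open>\<open>?G\<close> and \<open>V\<close> agree on all of \<open>J\<close>, so
      any positive radius serves here.\<close>
    then show ?thesis
      unfolding L_def by (rule has_field_derivative_transform_within[OF _ zero_less_one t])
        (use first in simp)
  qed
  then show "?G differentiable_on J"
    unfolding differentiable_on_def real_differentiable_def by blast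
  fix t assume t: "t \<in> J"
  have "\<gamma>1 t \<noteq> 0" using Epos[OF t] upos[OF t] Rpos[OF t] by (simp add: \<gamma>1)
  then show "conformable_SL k0 k1 p q I x t = \<gamma>1 t * conformable_deriv k0 k1 J ?G t"
    unfolding conformable_deriv_eq[OF second[OF t] nb[OF t]] using k0[OF t] by simp
qed

section \<open>Choice of the factors and the Trench factorization\<close>

theorem theorem10p4:
  fixes I :: "real set" and a :: real and b :: ereal
    and \<kappa>0 \<kappa>1 :: "real \<Rightarrow> real \<Rightarrow> real" and \<alpha> :: real
    and p q :: "real \<Rightarrow> real"
  assumes "is_interval I"
    and "0 < a" and "ereal a < b" and "Ico_ereal a b \<subseteq> I"
    and "conformable_kernels I \<kappa>0 \<kappa>1"
    and "0 < \<alpha>" and "\<alpha> \<le> 1"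
    and "continuous_on I p" and "continuous_on I q" and "\<forall>t\<in>I. 0 < p t"
    and "\<exists>u. conformable_solution (\<kappa>0 \<alpha>) (\<kappa>1 \<alpha>) p q (Ico_ereal a b) u
             \<and> (\<forall>t\<in>Ico_ereal a b. 0 < u t)"
  shows "\<exists>\<gamma>1 \<gamma>2 :: real \<Rightarrow> real.
    (\<forall>t\<in>Ico_ereal a b. 0 < \<gamma>1 t \<and> 0 < \<gamma>2 t) \<and>
    conformable_integral_infinite (\<kappa>0 \<alpha>) a b (\<lambda>t. 1 / \<gamma>2 t) \<and>
    (\<forall>x\<in>conformable_domain (\<kappa>0 \<alpha>) (\<kappa>1 \<alpha>) p I.
       (\<lambda>s. \<gamma>1 s * x s) differentiable_on Ico_ereal a b \<and>
       (\<lambda>s. \<gamma>2 s * conformable_deriv (\<kappa>0 \<alpha>) (\<kappa>1 \<alpha>) (Ico_ereal a b) (\<lambda>r. \<gamma>1 r * x r) s)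
         differentiable_on Ico_ereal a b \<and>
       (\<forall>t\<in>Ico_ereal a b.
          conformable_SL (\<kappa>0 \<alpha>) (\<kappa>1 \<alpha>) p q I x t =
          \<gamma>1 t * conformable_deriv (\<kappa>0 \<alpha>) (\<kappa>1 \<alpha>) (Ico_ereal a b)
            (\<lambda>s. \<gamma>2 s * conformable_deriv (\<kappa>0 \<alpha>) (\<kappa>1 \<alpha>) (Ico_ereal a b)
                     (\<lambda>r. \<gamma>1 r * x r) s) t))"
proof -
  let ?J = "Ico_ereal a b" and ?k0 = "\<kappa>0 \<alpha>" and ?k1 = "\<kappa>1 \<alpha>"
  have ker: "conformable_kernels I \<kappa>0 \<kappa>1" and JI: "?J \<subseteq> I" and ab: "ereal a < b"
    using assms by auto
  obtain u where u: "conformable_solution ?k0 ?k1 p q ?J u" and upos: "\<And>t. t \<in> ?J \<Longrightarrow> 0 < u t"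
    using assms(11) by blast
  have k0: "0 < ?k0 t" if "t \<in> ?J" for t
  proof -
    have "0 \<le> ?k0 t" "?k0 t \<noteq> 0"
      using ker that JI assms(6,7) unfolding conformable_kernels_def by auto
    then show ?thesis by simp
  qed
  have p: "0 < p t" if "t \<in> ?J" for t using that JI assms(10) by blast
  \<comment> \<open>Joint continuity of a kernel gives continuity in \<open>t\<close> at the fixed
    \<open>\<alpha>\<close>.\<close>
  have slice: "continuous_on ?J (\<kappa> \<alpha>)"
    if "continuous_on ({0..1} \<times> I) (\<lambda>(\<alpha>, t). \<kappa> \<alpha> t)" for \<kappa> :: "real \<Rightarrow> real \<Rightarrow> real"
  proof -
    have "continuous_on ?J (\<lambda>t. (\<alpha>, t))" by (intro continuous_intros)
    from continuous_on_compose2[OF that this] show ?thesis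
      using JI assms(6,7) by (auto simp: image_subset_iff)
  qed
  have k0_cont: "continuous_on ?J ?k0" and k1_cont: "continuous_on ?J ?k1"
    using ker slice by (auto simp: conformable_kernels_def)
  have p_cont: "continuous_on ?J p" using assms(8) JI by (rule continuous_on_subset)
  have u_cont: "continuous_on ?J u"
    using u by (auto simp: conformable_solution_def conformable_domain_def)
  have "continuous_on ?J (\<lambda>t. ?k1 t / ?k0 t)"
    using k0 by (auto intro!: continuous_intros k0_cont k1_cont simp: less_imp_neq[symmetric])
  then obtain K where K: "\<And>t. t \<in> ?J \<Longrightarrow> (K has_real_derivative ?k1 t / ?k0 t) (at t within ?J)"
    using Ico_ereal_antiderivative by blast
  \<comment> \<open>\<open>E\<close> is the positive function annihilated by the conformable
    derivative.\<close>
  define E where "E = (\<lambda>t. exp (- K t))"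
  have E: "(E has_real_derivative - (?k1 t / ?k0 t) * E t) (at t within ?J)" if "t \<in> ?J" for t
    unfolding E_def by (auto intro!: derivative_eq_intros K[OF that])
  have Epos: "0 < E t" for t by (simp add: E_def)
  \<comment> \<open>This is \<open>1/P\<close> for the Polya weight \<open>P\<close>.\<close>
  define h where "h = (\<lambda>t. (E t)\<^sup>2 / (p t * ?k0 t * (u t)\<^sup>2))"
  have "continuous_on ?J E" using E by (rule DERIV_continuous_on)
  then have h_cont: "continuous_on ?J h"
    unfolding h_def using k0 p upos
    by (auto intro!: continuous_intros k0_cont p_cont u_cont simp: less_imp_neq[symmetric])
  have hpos: "0 < h t" if "t \<in> ?J" for t
    using k0[OF that] p[OF that] upos[OF that] Epos[of t] by (simp add: h_def)
  obtain R c F where R: "\<forall>t\<in>?J. 0 < R t"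
      "\<forall>t\<in>?J. (R has_real_derivative - c * h t) (at t within ?J)"
    and F: "\<forall>t\<in>?J. (F has_real_derivative h t / (R t)\<^sup>2) (at t within ?J)"
      "\<forall>Z. \<exists>T\<in>?J. Z \<le> F T"
    by (rule divergent_rescaling[OF ab h_cont hpos])
  \<comment> \<open>Since \<open>D f = k0 E (f/E)'\<close>, the factor \<open>E\<close> enters
    \<open>\<gamma>1\<close>, and \<open>\<gamma>2\<close> is the rescaled weight
    \<open>P R\<^sup>2\<close> divided by \<open>k0\<close>.\<close>
  define \<gamma>1 where "\<gamma>1 = (\<lambda>t. E t / (u t * R t))"
  define \<gamma>2 where "\<gamma>2 = (\<lambda>t. p t * (u t * R t)\<^sup>2 / (E t)\<^sup>2)"
  have pos: "0 < \<gamma>1 t \<and> 0 < \<gamma>2 t" if "t \<in> ?J" for t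
    using p[OF that] upos[OF that] bspec[OF R(1) that] Epos[of t] by (simp add: \<gamma>1_def \<gamma>2_def)
  \<comment> \<open>The \<open>k0\<close> left out of \<open>\<gamma>2\<close> returns through
    \<open>dt / k0 t\<close>, so \<open>F\<close> is an antiderivative of the integrand whose
    divergence is claimed.\<close>
  have "h t / (R t)\<^sup>2 = 1 / \<gamma>2 t / ?k0 t" for t
    by (simp add: h_def \<gamma>2_def power_mult_distrib ac_simps)
  then have "conformable_integral_infinite ?k0 a b (\<lambda>t. 1 / \<gamma>2 t)"
    using F k0 pos by (intro conformable_integral_infinite_antiderivative[OF ab])
      (auto simp: less_imp_le)
  moreover note trench_factorization_pointwise[OF JI at_within_Ico_ereal_neq_bot k0 p u upos E Epos
      R(2)[unfolded h_def, rule_format] R(1)[rule_format] _ \<gamma>1_def \<gamma>2_def]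
  ultimately show ?thesis using pos by (intro exI[of _ \<gamma>1] exI[of _ \<gamma>2]) simp
qed

end
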